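(* For every integer $n \geq 0$, $$C_n = (-1)^n \frac{4^n\, Ch_{n,\frac{1}{2}}}{n!}.$$
   Context: $C_n = \frac{1}{n+1}\binom{2n}{n}$ denotes the $n$-th Catalan number. The $\frac12$-Changhee numbers $Ch_{n,\frac12}$ are defined by the formal power series identity $\frac{2}{1+\sqrt{1+t}} = \sum_{n\ge 0} Ch_{n,\frac12}\frac{t^n}{n!}$, where $\sqrt{1+t} = (1+t)^{1/2} = \sum_{n\ge0}\binom{1/2}{n}t^n$. *)

theory Defs
  imports Complex_Main "HOL-Computational_Algebra.Formal_Power_Series"
begin

definition catalan :: "nat \<Rightarrow> real" where
  "catalan n = 1 / (real n + 1) * real ((2 * n) choose n)"

text \<open>
  The division below takes place in the ring of formal power series over the reals. Its
  denominator has constant term 2, hence is a unit, so it is an exact quotient.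
\<close>

definition changhee_half_egf :: "real fps" where
  "changhee_half_egf = 2 / (1 + fps_binomial (1 / 2))"

definition changhee_half :: "nat \<Rightarrow> real" where
  "changhee_half n = fact n * fps_nth changhee_half_egf n"

lemma changhee_half_generating_function:
  "2 / (1 + fps_binomial (1 / 2)) = Abs_fps (\<lambda>n. changhee_half n / fact n)"
  by (simp add: fps_eq_iff changhee_half_def changhee_half_egf_def)

lemma changhee_half_egf_mult:
  "changhee_half_egf * (1 + fps_binomial (1 / 2)) = 2"
proof -
  have "fps_nth (1 + fps_binomial (1 / 2 :: real)) 0 \<noteq> 0"
    by simp
  then have "is_unit (1 + fps_binomial (1 / 2 :: real))"
    by (simp only: fps_is_unit_iff) simp
  then show ?thesis
    unfolding changhee_half_egf_def by (simp add: unit_imp_dvd)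
qed

end

theory Submission
  imports Defs
begin

text \<open>
  With s the square root of 1 + X, the identity (s + 1)(s - 1) = X turns the quotient
  2 / (1 + s) into 2 (s - 1) / X, so its coefficients are shifted binomial coefficients
  of 1/2. These satisfy the same first-order recurrence as the Catalan numbers, up to
  the factor -4.
\<close>

lemma changhee_half_egf_nth:
  "fps_nth changhee_half_egf n = 2 * ((1 / 2) gchoose Suc n)"
proof -
  define s :: "real fps" where "s = fps_binomial (1 / 2)"
  have "s * s = 1 + fps_X"
    using fps_binomial_add_mult[of "1 / 2 :: real" "1 / 2"]
    by (simp add: s_def fps_binomial_1)
  then have "(1 + s) * (s - 1) = fps_X"
    by (simp add: algebra_simps)
  then have "changhee_half_egf * fps_X = changhee_half_egf * (1 + s) * (s - 1)"
    by (simp add: mult.assoc)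
  also have "\<dots> = 2 * (s - 1)"
    using changhee_half_egf_mult by (simp add: s_def)
  \<comment> \<open>The factor X shifts the index by one, and at index \<open>Suc n\<close> the
    subtracted 1 contributes nothing.\<close>
  finally have "fps_nth (changhee_half_egf * fps_X) (Suc n) = fps_nth (2 * (s - 1)) (Suc n)"
    by simp
  then show ?thesis
    by (simp add: s_def fps_mult_fps_X_commute numeral_fps_const)
qed

lemma catalan_Suc:
  "catalan (Suc n) = catalan n * (4 * real n + 2) / (real n + 2)"
proof -
  have *: "catalan m = fact (2 * m) / ((real m + 1) * fact m * fact m)" for m
    by (simp add: catalan_def binomial_fact)
  have "fact (2 * Suc n) = (2 * real n + 2) * (2 * real n + 1) * fact (2 * n)"
    by (simp add: algebra_simps)
  then show ?thesis
    \<comment> \<open>Deleting \<open>mult_Suc_right\<close> keeps \<open>fact (2 * Suc n)\<close>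
      intact, so the chained equation can rewrite it.\<close>
    unfolding * by (simp add: divide_simps del: mult_Suc_right) (simp add: algebra_simps)
qed

lemma catalan_conv_gbinomial:
  "catalan n = (- 4) ^ n * (2 * ((1 / 2) gchoose Suc n))"
proof (induction n)
  case 0
  show ?case by (simp add: catalan_def)
next
  case (Suc n)
  \<comment> \<open>The numerator is 1/2 - (n + 1); multiplied by -4 it becomes 4n + 2, the factor
    in \<open>catalan_Suc\<close>.\<close>
  have "((1 / 2 :: real) gchoose Suc (Suc n)) =
      ((1 / 2) gchoose Suc n) * (- (real n + 1 / 2)) / (real n + 2)"
    using gbinomial_mult_1[of "1 / 2 :: real" "Suc n"]
    by (simp add: field_simps del: gbinomial_Suc)
  then show ?case
    by (simp only: catalan_Suc Suc.IH) (simp add: field_simps)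
qed

theorem theorem2:
  fixes n :: nat
  shows "catalan n = (-1) ^ n * (4 ^ n * changhee_half n / fact n)"
proof -
  have "(- 4 :: real) ^ n = (- 1) ^ n * 4 ^ n"
    by (simp flip: power_mult_distrib)
  then show ?thesis
    by (simp add: catalan_conv_gbinomial changhee_half_def changhee_half_egf_nth)
qed

end
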